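(* Let $S$ be a set and let $\vdash$ be a strong idempotent on $\mathsf{F}S$. Then the tight spectrum $\mathsf{T}^S$ is a stably locally compact space and, for all $F,G\in\mathsf{F}S$, \[F\Vdash G\quad\Leftrightarrow\quad \mathsf{T}_F\subseteq\mathsf{T}^G,\qquad\qquad F\vdash G\quad\Rightarrow\quad \mathsf{T}_F\Subset\mathsf{T}^G .\] If moreover $\vdash$ is a cover relation, then the converse implication also holds in the second statement, i.e. $F\vdash G\Leftrightarrow\mathsf{T}_F\Subset\mathsf{T}^G$ for all $F,G\in\mathsf{F}S$.
   Context: $\mathsf{F}S$ is the set of all finite subsets of $S$ (including $\emptyset$). For $\mathcal{F}\subseteq\mathsf{F}S$, $\mathcal{F}_\between=\{G\in\mathsf{F}S: G\cap F\neq\emptyset\text{ for all }F\in\mathcal{F}\}$. For $\mathcal{F},\mathcal{G}\in\mathsf{F}\mathsf{F}S$, $\mathcal{F}\bowtie\mathcal{G}$ means every element of $\mathcal{F}_\between$ contains some element of $\mathcal{G}$ as a subset. For $\vdash\ \subseteq R\times\mathsf{F}S$ and $\vDash\ \subseteq\mathsf{F}S\times T$, the cut-composition $\vdash\bullet\vDash\ \subseteq R\times T$ is: $r\vdash\bullet\vDash t$ iff there are $\mathcal{F},\mathcal{G}\in\mathsf{F}\mathsf{F}S$ with $\mathcal{F}\bowtie\mathcal{G}$, $r\vdash F$ for all $F\in\mathcal{F}$, and $G\vDash t$ for all $G\in\mathcal{G}$. For a relation $\vdash$ on $\mathsf{F}S$: $F\vdash_{1\exists}G$ iff $F\vdash\{g\}$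 for some $g\in G$. $\vdash$ is monotone if $F\vdash G$, $F\subseteq F'$, $G\subseteq G'$ imply $F'\vdash G'$ (all in $\mathsf{F}S$). A strong idempotent is a monotone relation $\vdash$ on $\mathsf{F}S$ with $\vdash\bullet\vdash\ \subseteq\ \vdash\ \subseteq\ \vdash\bullet\vdash_{1\exists}$. Put $\mathsf{B}S=\{F\in\mathsf{F}S:\exists G\in\mathsf{F}S\ (F\vdash G)\}$, and define $\Vdash$ on $\mathsf{F}S$ by: $F\Vdash G$ iff for all $H\in\mathsf{B}S$, if $H\vdash\{f\}$ for all $f\in F$ then $H\vdash G$. A cover relation is a strong idempotent $\vdash$ that is auxiliary to $\Vdash$, i.e. for all $F,G,H\in\mathsf{F}S$: if $F\Vdash H$ and $\{h\}\cup F\vdash G$ for all $h\in H$, then $F\vdash G$. $T\subseteq S$ is tight if for all $G\in\mathsf{F}S$: ($F\vdash G$ for some finite $F\subseteq T$) iff $T\cap G\neq\emptyset$. For $Q\subseteq S$, $\mathsf{T}_Q$ is the set of non-empty tight $T$ with $Q\subseteq T$, and $\mathsf{T}^Q$ is the set of (non-empty) tight $T$ with $Q\cap T\neq\emptyset$; $\mathsf{T}_p=\mathsf{T}_{\{p\}}$. The tight spectrum is $\mathsf{T}^S$, the set of all non-empty tight subsets, with the topology generated by the subbasis $(\mathsf{T}_p)_{p\in S}$. In a topological space $X$, for $p,q\subseteq X$, $p\Subset q$ means every cover of $q$ by open sets of $X$ has a finite subfamily covering $p$. $X$ is core compact if whenever $x\in p$ with $p$ open there is an open $q$ with $x\in q\Subset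 p$; core coherent if for open $p,q,r$, $p\Subset q$ and $p\Subset r$ imply $p\Subset q\cap r$; stably locally compact if it is core compact, core coherent and sober (every irreducible closed set is the closure of a unique point). The whole space need not be compact. *)

theory Defs
  imports "HOL-Analysis.Analysis"
begin

(* The finite subsets of S form Fpow S.  A relation on Fpow S is a predicate
   E :: 'a set => 'a set => bool that relates only elements of Fpow S, and
   E F G is read "F |- G". *)


section \<open>Relations between finite sets\<close>

definition rel_on_Fpow :: "'a set \<Rightarrow> ('a set \<Rightarrow> 'a set \<Rightarrow> bool) \<Rightarrow> bool" where
  "rel_on_Fpow S E \<longleftrightarrow> (\<forall>F G. E F G \<longrightarrow> F \<in> Fpow S \<and> G \<in> Fpow S)"

definition transversals :: "'a set \<Rightarrow> 'a set set \<Rightarrow> 'a set set" where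
  "transversals S \<F> = {G \<in> Fpow S. \<forall>F\<in>\<F>. G \<inter> F \<noteq> {}}"

definition bowtie :: "'a set \<Rightarrow> 'a set set \<Rightarrow> 'a set set \<Rightarrow> bool" where
  "bowtie S \<F> \<G> \<longleftrightarrow> (\<forall>H \<in> transversals S \<F>. \<exists>G\<in>\<G>. G \<subseteq> H)"

(* The outer carriers of the two relations are not arguments here.  Because the
   families may be empty, cut_comp can hold outside those carriers, so an inclusion
   involving it has to be stated on the carriers. *)
definition cut_comp ::
    "'a set \<Rightarrow> ('r \<Rightarrow> 'a set \<Rightarrow> bool) \<Rightarrow> ('a set \<Rightarrow> 't \<Rightarrow> bool) \<Rightarrow> 'r \<Rightarrow> 't \<Rightarrow> bool" where
  "cut_comp S A B r t \<longleftrightarrow>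
     (\<exists>\<F> \<in> Fpow (Fpow S). \<exists>\<G> \<in> Fpow (Fpow S).
        bowtie S \<F> \<G> \<and> (\<forall>F\<in>\<F>. A r F) \<and> (\<forall>G\<in>\<G>. B G t))"

definition one_ex :: "('a set \<Rightarrow> 'a set \<Rightarrow> bool) \<Rightarrow> 'a set \<Rightarrow> 'a set \<Rightarrow> bool" where
  "one_ex E F G \<longleftrightarrow> (\<exists>g\<in>G. E F {g})"

definition monotone_rel :: "'a set \<Rightarrow> ('a set \<Rightarrow> 'a set \<Rightarrow> bool) \<Rightarrow> bool" where
  "monotone_rel S E \<longleftrightarrow>
     (\<forall>F \<in> Fpow S. \<forall>F' \<in> Fpow S. \<forall>G \<in> Fpow S. \<forall>G' \<in> Fpow S.
        E F G \<and> F \<subseteq> F' \<and> G \<subseteq> G' \<longrightarrow> E F' G')"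

definition strong_idempotent :: "'a set \<Rightarrow> ('a set \<Rightarrow> 'a set \<Rightarrow> bool) \<Rightarrow> bool" where
  "strong_idempotent S E \<longleftrightarrow>
     rel_on_Fpow S E \<and>
     monotone_rel S E \<and>
     (\<forall>F \<in> Fpow S. \<forall>G \<in> Fpow S. cut_comp S E E F G \<longrightarrow> E F G) \<and>
     (\<forall>F \<in> Fpow S. \<forall>G \<in> Fpow S. E F G \<longrightarrow> cut_comp S E (one_ex E) F G)"

definition bounded_sets :: "'a set \<Rightarrow> ('a set \<Rightarrow> 'a set \<Rightarrow> bool) \<Rightarrow> 'a set set" where
  "bounded_sets S E = {F \<in> Fpow S. \<exists>G \<in> Fpow S. E F G}"

(* The double-turnstile relation on Fpow S induced by E. *)
definition Vdash :: "'a set \<Rightarrow> ('a set \<Rightarrow> 'a set \<Rightarrow> bool) \<Rightarrow> 'a set \<Rightarrow> 'a set \<Rightarrow> bool" where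
  "Vdash S E F G \<longleftrightarrow>
     F \<in> Fpow S \<and> G \<in> Fpow S \<and>
     (\<forall>H \<in> bounded_sets S E. (\<forall>f\<in>F. E H {f}) \<longrightarrow> E H G)"

definition auxiliary_to ::
    "'a set \<Rightarrow> ('a set \<Rightarrow> 'a set \<Rightarrow> bool) \<Rightarrow> ('a set \<Rightarrow> 'a set \<Rightarrow> bool) \<Rightarrow> bool" where
  "auxiliary_to S E D \<longleftrightarrow>
     (\<forall>F \<in> Fpow S. \<forall>G \<in> Fpow S. \<forall>H \<in> Fpow S.
        D F H \<and> (\<forall>h\<in>H. E ({h} \<union> F) G) \<longrightarrow> E F G)"

definition cover_relation :: "'a set \<Rightarrow> ('a set \<Rightarrow> 'a set \<Rightarrow> bool) \<Rightarrow> bool" where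
  "cover_relation S E \<longleftrightarrow> strong_idempotent S E \<and> auxiliary_to S E (Vdash S E)"


section \<open>The tight spectrum\<close>

definition tight :: "'a set \<Rightarrow> ('a set \<Rightarrow> 'a set \<Rightarrow> bool) \<Rightarrow> 'a set \<Rightarrow> bool" where
  "tight S E T \<longleftrightarrow>
     T \<subseteq> S \<and> (\<forall>G \<in> Fpow S. (\<exists>F. finite F \<and> F \<subseteq> T \<and> E F G) \<longleftrightarrow> T \<inter> G \<noteq> {})"

(* The subscript and superscript families T_Q and T^Q, in that order. *)
definition tight_sub :: "'a set \<Rightarrow> ('a set \<Rightarrow> 'a set \<Rightarrow> bool) \<Rightarrow> 'a set \<Rightarrow> 'a set set" where
  "tight_sub S E Q = {T. tight S E T \<and> T \<noteq> {} \<and> Q \<subseteq> T}"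

definition tight_sup :: "'a set \<Rightarrow> ('a set \<Rightarrow> 'a set \<Rightarrow> bool) \<Rightarrow> 'a set \<Rightarrow> 'a set set" where
  "tight_sup S E Q = {T. tight S E T \<and> T \<noteq> {} \<and> Q \<inter> T \<noteq> {}}"

definition tight_spectrum :: "'a set \<Rightarrow> ('a set \<Rightarrow> 'a set \<Rightarrow> bool) \<Rightarrow> 'a set topology" where
  "tight_spectrum S E = topology_generated_by ((\<lambda>p. tight_sub S E {p}) ` S)"

lemma topspace_tight_spectrum: "topspace (tight_spectrum S E) = tight_sup S E S"
  by (auto simp: tight_spectrum_def tight_sub_def tight_sup_def)

lemma tight_sup_whole: "tight_sup S E S = {T. tight S E T \<and> T \<noteq> {}}"
  by (auto simp: tight_sup_def tight_def)


section \<open>Stably locally compact spaces\<close>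

definition compactly_inside :: "'a topology \<Rightarrow> 'a set \<Rightarrow> 'a set \<Rightarrow> bool" where
  "compactly_inside X p q \<longleftrightarrow>
     p \<subseteq> topspace X \<and> q \<subseteq> topspace X \<and>
     (\<forall>\<U>. (\<forall>U\<in>\<U>. openin X U) \<and> q \<subseteq> \<Union>\<U> \<longrightarrow>
        (\<exists>\<V>. finite \<V> \<and> \<V> \<subseteq> \<U> \<and> p \<subseteq> \<Union>\<V>))"

definition core_compact :: "'a topology \<Rightarrow> bool" where
  "core_compact X \<longleftrightarrow>
     (\<forall>p x. openin X p \<and> x \<in> p \<longrightarrow> (\<exists>q. openin X q \<and> x \<in> q \<and> compactly_inside X q p))"

definition core_coherent :: "'a topology \<Rightarrow> bool" where
  "core_coherent X \<longleftrightarrow>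
     (\<forall>p q r. openin X p \<and> openin X q \<and> openin X r \<and>
        compactly_inside X p q \<and> compactly_inside X p r \<longrightarrow> compactly_inside X p (q \<inter> r))"

definition irreducible_closedin :: "'a topology \<Rightarrow> 'a set \<Rightarrow> bool" where
  "irreducible_closedin X C \<longleftrightarrow>
     closedin X C \<and> C \<noteq> {} \<and>
     (\<forall>A B. closedin X A \<and> closedin X B \<and> C = A \<union> B \<longrightarrow> C = A \<or> C = B)"

definition sober_space :: "'a topology \<Rightarrow> bool" where
  "sober_space X \<longleftrightarrow>
     (\<forall>C. irreducible_closedin X C \<longrightarrow> (\<exists>!x. x \<in> topspace X \<and> C = X closure_of {x}))"

definition stably_locally_compact :: "'a topology \<Rightarrow> bool" where
  "stably_locally_compact X \<longleftrightarrow> core_compact X \<and> core_coherent X \<and> sober_space X"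

end

theory Submission
  imports Defs
begin

text \<open>
  Read a finite set \<open>K \<subseteq> S\<close> as the disjunction of its elements, and a family of finite sets as
  a conjunction of such clauses. The cut and interpolation laws of a strong idempotent then say
  that \<open>{K. H \<turnstile> K}\<close> is a theory of clauses, closed under deduction by \<open>\<turnstile>\<close>, in which every clause
  follows from finitely many members, in the sense that each of their transversals already entails
  a single one of its disjuncts
  (\<open>round_theory_consequences\<close>). Call such a family a \<^emph>\<open>round theory\<close>. A prime round theory, one
  that contains a unit clause below each of its clauses, is the same as a tight set.

  Everything rests on one prime ideal theorem, \<open>tight_model_avoiding\<close>: if no finite part
  \<open>\<F>\<close> of a round theory \<open>\<R>\<close> satisfies \<open>\<F> \<bowtie> \<A>\<close>, then some tight set meets every clause of \<open>\<R>\<close> and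
  includes no finite member of \<open>\<A>\<close>. By Zorn there is a maximal round theory with this property, and it
  is prime: a clause \<open>K\<close> follows through its disjuncts from finitely many clauses \<open>\<F>\<close>, and by
  \<open>covered_by_cases\<close> some transversal \<open>A\<close> of \<open>\<F>\<close> can be adjoined without losing the property. By
  maximality nothing new is gained, but \<open>A\<close> entails a unit clause below \<open>K\<close>.

  Three consequences give the theorem.
  \<^item> With \<open>\<A>\<close> the singletons of \<open>G\<close>, a clause that meets all models of a nonempty \<open>\<R>\<close> belongs to \<open>\<R>\<close>
    (\<open>models_subset_tight_sup_imp_mem\<close>). For \<open>\<R> = {K. H \<turnstile> K}\<close> this is the description of \<open>\<Turnstile>\<close>.
  \<^item> With \<open>\<A>\<close> the basic open sets below an open cover, the set of nonempty models of a nonempty \<open>\<R>\<close>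
    is compact (\<open>compactin_models\<close>). Since \<open>\<T>\<^sub>H\<close> lies inside the models of \<open>{K. H \<turnstile> K}\<close>, these compact
    sets interpolate: \<open>p\<close> is compactly inside an open \<open>q\<close> iff finitely many sets \<open>\<T>\<^sub>H\<close> cover \<open>p\<close> such that
    the models of each \<open>{K. H \<turnstile> K}\<close> lie in \<open>q\<close> (\<open>compactly_inside_iff_inner_approx\<close>). Core compactness and
    \<open>F \<turnstile> G \<Longrightarrow> \<T>\<^sub>F \<Subset> \<T>\<^sup>G\<close> are immediate, and core coherence follows because two such covers are
    intersected by taking unions \<open>H \<union> H'\<close>. Sobriety is a direct computation: the generic point of
    an irreducible closed set is its union.
  \<^item> If \<open>\<T>\<^sub>F \<Subset> \<T>\<^sup>G\<close>, this interpolation yields finitely many \<open>H\<close> with \<open>H \<turnstile> G\<close> such that the sets \<open>\<T>\<^sub>H\<close>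
    cover \<open>\<T>\<^sub>F\<close>. Distributing the disjunction of the conjunctions \<open>H\<close> into a conjunction of clauses
    \<open>K\<close>, one gets \<open>F \<Turnstile> K\<close> for each of them, and auxiliarity, applied once per clause, gives \<open>F \<turnstile> G\<close>.
\<close>

section \<open>Transversals of finite families\<close>

lemma transversals_antimono: "\<F> \<subseteq> \<G> \<Longrightarrow> transversals S \<G> \<subseteq> transversals S \<F>"
  by (auto simp: transversals_def)

text \<open>
  All transversals of a finite family of finite sets include one of these, and there are only
  finitely many of them; this reduces statements about all transversals to finite choices.
\<close>
definition core_transversals :: "'a set \<Rightarrow> 'a set set \<Rightarrow> 'a set set" where
  "core_transversals S \<F> = {B \<in> transversals S \<F>. B \<subseteq> \<Union>\<F>}"

lemma core_transversalD: "B \<in> core_transversals S \<F> \<Longrightarrow> B \<in> transversals S \<F>"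
  by (simp add: core_transversals_def)

lemma core_transversals_Fpow: "core_transversals S \<F> \<subseteq> Fpow S"
  by (auto simp: core_transversals_def transversals_def)

lemma transversal_Int_Union:
  assumes "H \<in> transversals S \<F>"
  shows "H \<inter> \<Union>\<F> \<in> core_transversals S \<F>"
  using assms unfolding core_transversals_def transversals_def Fpow_def by fastforce

lemma finite_core_transversals:
  assumes "\<F> \<in> Fpow (Fpow S)"
  shows "finite (core_transversals S \<F>)"
proof -
  have "finite (\<Union>\<F>)" using assms by (auto simp: Fpow_def)
  then show ?thesis
    by (rule_tac finite_subset[of _ "Pow (\<Union>\<F>)"]) (auto simp: core_transversals_def)
qed

text \<open>
  Distributivity: read as conjunctions of clauses, the families \<open>\<F> i\<close> have a disjunction that is
  again a conjunction of clauses, namely of all unions of one clause from each family.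
\<close>
lemma disjunction_of_families:
  assumes "finite I" and fam: "\<And>i. i \<in> I \<Longrightarrow> \<F> i \<in> Fpow (Fpow S)"
  shows "\<exists>\<J>\<in>Fpow (Fpow S). (\<forall>J\<in>\<J>. \<forall>i\<in>I. \<exists>F\<in>\<F> i. F \<subseteq> J) \<and>
    (\<forall>C\<in>transversals S \<J>. \<exists>i\<in>I. C \<in> transversals S (\<F> i))"
proof -
  let ?J = "(\<lambda>c. \<Union>i\<in>I. c i) ` PiE I \<F>"
  have "finite (PiE I \<F>)"
    using assms by (intro finite_PiE) (auto simp: Fpow_def)
  moreover have "(\<Union>i\<in>I. c i) \<in> Fpow S" if c: "c \<in> PiE I \<F>" for c
  proof -
    have "c i \<in> Fpow S" if "i \<in> I" for i
      using fam[OF that] PiE_mem[OF c that] by (auto simp: Fpow_def)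
    then show ?thesis using \<open>finite I\<close> by (auto simp: Fpow_def)
  qed
  ultimately have fin: "?J \<in> Fpow (Fpow S)" by (auto simp: Fpow_def)
  have up: "\<exists>F\<in>\<F> i. F \<subseteq> J" if "J \<in> ?J" "i \<in> I" for J i
    using that by (auto dest: PiE_mem)
  have trans: "\<exists>i\<in>I. C \<in> transversals S (\<F> i)" if C: "C \<in> transversals S ?J" for C
  proof (rule ccontr)
    \<comment> \<open>Otherwise every family has a member missing \<open>C\<close>, and the union of these members
      is a member of the disjunction missing \<open>C\<close>.\<close>
    assume "\<not> ?thesis"
    then have "\<exists>F\<in>\<F> i. C \<inter> F = {}" if "i \<in> I" for i
      using C that by (auto simp: transversals_def)
    then obtain c where c: "\<And>i. i \<in> I \<Longrightarrow> c i \<in> \<F> i \<and> C \<inter> c i = {}" by metis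
    have "(\<Union>i\<in>I. restrict c I i) \<in> ?J"
      using c by (intro imageI) auto
    then have "C \<inter> (\<Union>i\<in>I. restrict c I i) \<noteq> {}" using C by (auto simp: transversals_def)
    then show False using c by auto
  qed
  show ?thesis
    using fin up trans by (intro bexI[of _ ?J] conjI ballI)
qed

section \<open>Round theories\<close>

locale strong_idempotent_rel =
  fixes S :: "'a set" and E :: "'a set \<Rightarrow> 'a set \<Rightarrow> bool" (infix "\<turnstile>" 50)
  assumes strong_idempotent: "strong_idempotent S E"
begin

lemma entails_carrier: "F \<turnstile> G \<Longrightarrow> F \<in> Fpow S" "F \<turnstile> G \<Longrightarrow> G \<in> Fpow S"
  using strong_idempotent unfolding strong_idempotent_def rel_on_Fpow_def by blast+

lemma entails_mono:
  assumes "F \<turnstile> G" "F \<subseteq> F'" "G \<subseteq> G'" "F' \<in> Fpow S" "G' \<in> Fpow S"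
  shows "F' \<turnstile> G'"
  using strong_idempotent assms entails_carrier[OF assms(1)]
  unfolding strong_idempotent_def monotone_rel_def by blast

text \<open>
  The family \<open>\<G>\<close> in a cut may always be taken to consist of transversals of \<open>\<F>\<close>, so it can be
  eliminated both from cut (here) and from interpolation (below).
\<close>
lemma entails_cut:
  assumes "F \<in> Fpow S" "G \<in> Fpow S" "finite \<F>"
    and FF: "\<And>K. K \<in> \<F> \<Longrightarrow> F \<turnstile> K"
    and B: "\<And>B. B \<in> transversals S \<F> \<Longrightarrow> B \<turnstile> G"
  shows "F \<turnstile> G"
proof -
  have mem: "\<F> \<in> Fpow (Fpow S)"
    using FF entails_carrier(2) \<open>finite \<F>\<close> by (auto simp: Fpow_def)
  let ?G = "core_transversals S \<F>"
  have "?G \<in> Fpow (Fpow S)"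
    using finite_core_transversals[OF mem] core_transversals_Fpow[of S \<F>] by (auto simp: Fpow_def)
  moreover have "bowtie S \<F> ?G"
    unfolding bowtie_def using transversal_Int_Union by blast
  ultimately have "cut_comp S E E F G"
    unfolding cut_comp_def using mem FF B[OF core_transversalD] by blast
  then show ?thesis
    using strong_idempotent assms(1,2) by (auto simp: strong_idempotent_def)
qed

lemma entails_interpolate:
  assumes "F \<turnstile> G"
  obtains \<F> where "finite \<F>" "\<And>K. K \<in> \<F> \<Longrightarrow> F \<turnstile> K"
    "\<And>B. B \<in> transversals S \<F> \<Longrightarrow> \<exists>g\<in>G. B \<turnstile> {g}"
proof -
  have "cut_comp S E (one_ex E) F G"
    using strong_idempotent assms entails_carrier[OF assms]
    by (auto simp: strong_idempotent_def)
  then obtain \<F> \<G> where *: "\<F> \<in> Fpow (Fpow S)" "bowtie S \<F> \<G>" "\<forall>K\<in>\<F>. F \<turnstile> K"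
      "\<forall>H\<in>\<G>. one_ex E H G"
    unfolding cut_comp_def by blast
  have "\<exists>g\<in>G. B \<turnstile> {g}" if B: "B \<in> transversals S \<F>" for B
  proof -
    obtain H where "H \<in> \<G>" "H \<subseteq> B" using B *(2) by (auto simp: bowtie_def)
    then obtain g where "g \<in> G" "H \<turnstile> {g}" using *(4) by (auto simp: one_ex_def)
    moreover have "B \<in> Fpow S" using B by (auto simp: transversals_def)
    ultimately show ?thesis
      using entails_mono[of H "{g}" B "{g}"] \<open>H \<subseteq> B\<close> entails_carrier(2) by auto
  qed
  moreover have "finite \<F>" using *(1) by (auto simp: Fpow_def)
  ultimately show thesis using that *(3) by blast
qed

text \<open>
  A nonempty round theory describes a compact saturated set of the spectrum by clauses that all of
  its points satisfy. The last condition mirrors the interpolation property; it is the reason why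
  each element of the set read off from a prime round theory is entailed by a finite part of it.
\<close>
definition round_theory :: "'a set set \<Rightarrow> bool" where
  "round_theory \<R> \<longleftrightarrow> \<R> \<subseteq> Fpow S \<and>
     (\<forall>G\<in>Fpow S. \<forall>\<F>\<in>Fpow \<R>. (\<forall>B\<in>transversals S \<F>. B \<turnstile> G) \<longrightarrow> G \<in> \<R>) \<and>
     (\<forall>G\<in>\<R>. \<exists>\<F>\<in>Fpow \<R>. \<forall>B\<in>transversals S \<F>. \<exists>g\<in>G. B \<turnstile> {g})"

lemma round_theory_Fpow: "round_theory \<R> \<Longrightarrow> \<R> \<subseteq> Fpow S"
  and round_theory_cut:
    "round_theory \<R> \<Longrightarrow> G \<in> Fpow S \<Longrightarrow> \<F> \<in> Fpow \<R> \<Longrightarrow>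
       (\<And>B. B \<in> transversals S \<F> \<Longrightarrow> B \<turnstile> G) \<Longrightarrow> G \<in> \<R>"
  and round_theory_interpolate:
    "round_theory \<R> \<Longrightarrow> G \<in> \<R> \<Longrightarrow>
       \<exists>\<F>\<in>Fpow \<R>. \<forall>B\<in>transversals S \<F>. \<exists>g\<in>G. B \<turnstile> {g}"
  unfolding round_theory_def by blast+

lemma round_theory_finite_family:
  assumes "round_theory \<R>" "\<F> \<in> Fpow \<R>"
  shows "\<F> \<in> Fpow (Fpow S)"
  using assms round_theory_Fpow by (auto simp: Fpow_def)

lemma round_theory_cut_witness:
  assumes "round_theory \<R>" "G \<in> \<R>"
  obtains \<F> where "\<F> \<in> Fpow \<R>" "\<And>B. B \<in> transversals S \<F> \<Longrightarrow> B \<turnstile> G"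
proof -
  have G: "G \<in> Fpow S" using assms round_theory_Fpow by auto
  obtain \<F> where F: "\<F> \<in> Fpow \<R>" "\<forall>B\<in>transversals S \<F>. \<exists>g\<in>G. B \<turnstile> {g}"
    using round_theory_interpolate[OF assms] by blast
  have "B \<turnstile> G" if "B \<in> transversals S \<F>" for B
  proof -
    obtain g where g: "g \<in> G" "B \<turnstile> {g}" using F(2) \<open>B \<in> transversals S \<F>\<close> by blast
    then show ?thesis
      using entails_mono[OF g(2), of B G] G entails_carrier(1)[OF g(2)] by auto
  qed
  then show thesis using that F by blast
qed

lemma round_theory_upward:
  assumes "round_theory \<R>" "G \<in> \<R>" "G \<subseteq> G'" "G' \<in> Fpow S"
  shows "G' \<in> \<R>"
proof -
  obtain \<F> where F: "\<F> \<in> Fpow \<R>" "\<And>B. B \<in> transversals S \<F> \<Longrightarrow> B \<turnstile> G"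
    using round_theory_cut_witness[OF assms(1,2)] by blast
  show ?thesis
  proof (rule round_theory_cut[OF assms(1,4) F(1)])
    show "B \<turnstile> G'" if "B \<in> transversals S \<F>" for B
      using entails_mono[OF F(2)[OF that], of B G'] assms(3,4) entails_carrier(1)[OF F(2)[OF that]]
      by blast
  qed
qed

lemma round_theory_consequences:
  assumes H: "H \<in> Fpow S"
  shows "round_theory {K. H \<turnstile> K}"
  unfolding round_theory_def
proof (intro conjI ballI impI)
  show "{K. H \<turnstile> K} \<subseteq> Fpow S" using entails_carrier by auto
next
  fix G \<F>
  assume G: "G \<in> Fpow S" and F: "\<F> \<in> Fpow {K. H \<turnstile> K}" "\<forall>B\<in>transversals S \<F>. B \<turnstile> G"
  show "G \<in> {K. H \<turnstile> K}"
    using entails_cut[OF H G, of \<F>] F by (auto simp: Fpow_def)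
next
  fix G assume "G \<in> {K. H \<turnstile> K}"
  then have "H \<turnstile> G" by simp
  then obtain \<F> where F: "finite \<F>" "\<And>K. K \<in> \<F> \<Longrightarrow> H \<turnstile> K"
    "\<And>B. B \<in> transversals S \<F> \<Longrightarrow> \<exists>g\<in>G. B \<turnstile> {g}"
    using entails_interpolate by metis
  have "\<F> \<in> Fpow {K. H \<turnstile> K}" using F(1,2) by (auto simp: Fpow_def)
  then show "\<exists>\<F>\<in>Fpow {K. H \<turnstile> K}. \<forall>B\<in>transversals S \<F>. \<exists>g\<in>G. B \<turnstile> {g}"
    using F(3) by blast
qed

section \<open>Prime extensions of round theories\<close>

text \<open>
  The consequences of \<open>\<R>\<close> together with the atoms in \<open>A\<close>. As \<open>\<turnstile>\<close> need not be reflexive, an atom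
  \<open>a \<in> A\<close> need not itself be among them; only what \<open>A\<close>
  entails, alone or with clauses of \<open>\<R>\<close>, is.
\<close>
definition adjoin :: "'a set set \<Rightarrow> 'a set \<Rightarrow> 'a set set" where
  "adjoin \<R> A = {G \<in> Fpow S. \<exists>\<F>\<in>Fpow \<R>. \<forall>B\<in>transversals S \<F>. A \<union> B \<turnstile> G}"

lemma adjoinI:
  assumes "G \<in> Fpow S" "\<F> \<in> Fpow \<R>" "\<And>B. B \<in> transversals S \<F> \<Longrightarrow> A \<union> B \<turnstile> G"
  shows "G \<in> adjoin \<R> A"
  using assms unfolding adjoin_def by blast

lemma finite_UN_Fpow:
  assumes "finite I" "\<And>i. i \<in> I \<Longrightarrow> \<F> i \<in> Fpow \<R>"
  shows "(\<Union>i\<in>I. \<F> i) \<in> Fpow \<R>"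
  using assms by (auto simp: Fpow_def)

lemma subset_adjoin:
  assumes R: "round_theory \<R>" and A: "A \<in> Fpow S"
  shows "\<R> \<subseteq> adjoin \<R> A"
proof
  fix G assume G: "G \<in> \<R>"
  obtain \<F> where F: "\<F> \<in> Fpow \<R>" "\<And>B. B \<in> transversals S \<F> \<Longrightarrow> B \<turnstile> G"
    using round_theory_cut_witness[OF R G] by blast
  show "G \<in> adjoin \<R> A"
  proof (rule adjoinI[OF _ F(1)])
    show GS: "G \<in> Fpow S" using G round_theory_Fpow[OF R] by auto
    fix B assume B: "B \<in> transversals S \<F>"
    then have "A \<union> B \<in> Fpow S" using A by (auto simp: transversals_def Fpow_def)
    then show "A \<union> B \<turnstile> G" using entails_mono[OF F(2)[OF B], of "A \<union> B" G] GS by auto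
  qed
qed

lemma singleton_in_adjoin:
  assumes "A \<turnstile> {k}"
  shows "{k} \<in> adjoin \<R> A"
proof (rule adjoinI[of _ "{}"])
  show "{k} \<in> Fpow S" using entails_carrier(2)[OF assms] .
  show "A \<union> B \<turnstile> {k}" if "B \<in> transversals S {}" for B
    using entails_mono[OF assms, of "A \<union> B" "{k}"] entails_carrier[OF assms] that
    by (auto simp: transversals_def Fpow_def)
qed (auto simp: Fpow_def)

text \<open>
  Only the last condition on a round theory takes work. A clause \<open>G\<close> obtained from \<open>\<F>\<close> is entailed by
  \<open>A \<union> B\<close> for each of the finitely many core transversals \<open>B\<close> of \<open>\<F>\<close>, and each of these entailments
  interpolates through its own family. The disjunction of these families is a common interpolant.
\<close>
lemma round_theory_adjoin:
  assumes R: "round_theory \<R>" and A: "A \<in> Fpow S"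
  shows "round_theory (adjoin \<R> A)"
  unfolding round_theory_def
proof (intro conjI ballI impI)
  show "adjoin \<R> A \<subseteq> Fpow S" by (auto simp: adjoin_def)
next
  fix G \<F>
  assume G: "G \<in> Fpow S" and F: "\<F> \<in> Fpow (adjoin \<R> A)" and GF: "\<forall>B\<in>transversals S \<F>. B \<turnstile> G"
  have "\<forall>F\<in>\<F>. \<exists>\<G>\<in>Fpow \<R>. \<forall>B\<in>transversals S \<G>. A \<union> B \<turnstile> F"
    using F by (auto simp: Fpow_def adjoin_def)
  then obtain \<G> where GG: "\<And>F. F \<in> \<F> \<Longrightarrow> \<G> F \<in> Fpow \<R>"
    "\<And>F B. F \<in> \<F> \<Longrightarrow> B \<in> transversals S (\<G> F) \<Longrightarrow> A \<union> B \<turnstile> F"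
    by metis
  have fin: "finite \<F>" using F by (auto simp: Fpow_def)
  show "G \<in> adjoin \<R> A"
  proof (rule adjoinI[OF G finite_UN_Fpow[OF fin GG(1)]])
    fix B assume B: "B \<in> transversals S (\<Union>F\<in>\<F>. \<G> F)"
    show "A \<union> B \<turnstile> G"
    proof (rule entails_cut[OF _ G fin])
      show "A \<union> B \<in> Fpow S" using A B by (auto simp: transversals_def Fpow_def)
      show "A \<union> B \<turnstile> F" if "F \<in> \<F>" for F
        using GG(2)[OF that, of B] B transversals_antimono[of "\<G> F" "\<Union>F\<in>\<F>. \<G> F" S] that by auto
    qed (use GF in auto)
  qed
next
  fix G assume "G \<in> adjoin \<R> A"
  then obtain \<F> where F: "\<F> \<in> Fpow \<R>" "\<And>B. B \<in> transversals S \<F> \<Longrightarrow> A \<union> B \<turnstile> G"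
    unfolding adjoin_def by blast
  let ?I = "core_transversals S \<F>"
  have finI: "finite ?I"
    by (rule finite_core_transversals[OF round_theory_finite_family[OF R F(1)]])
  have "\<exists>\<G>. finite \<G> \<and> (\<forall>K\<in>\<G>. A \<union> B \<turnstile> K) \<and> (\<forall>C\<in>transversals S \<G>. \<exists>g\<in>G. C \<turnstile> {g})"
    if "B \<in> ?I" for B
  proof -
    have "A \<union> B \<turnstile> G" using F(2)[OF core_transversalD[OF that]] .
    then show ?thesis by (rule entails_interpolate) blast
  qed
  then obtain \<G> where "\<And>B. B \<in> ?I \<Longrightarrow> finite (\<G> B) \<and> (\<forall>K\<in>\<G> B. A \<union> B \<turnstile> K) \<and>
     (\<forall>C\<in>transversals S (\<G> B). \<exists>g\<in>G. C \<turnstile> {g})"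
    by metis
  then have GG: "\<And>B. B \<in> ?I \<Longrightarrow> finite (\<G> B)"
     "\<And>B K. B \<in> ?I \<Longrightarrow> K \<in> \<G> B \<Longrightarrow> A \<union> B \<turnstile> K"
     "\<And>B C. B \<in> ?I \<Longrightarrow> C \<in> transversals S (\<G> B) \<Longrightarrow> \<exists>g\<in>G. C \<turnstile> {g}"
    by blast+
  have fam: "\<G> B \<in> Fpow (Fpow S)" if "B \<in> ?I" for B
    using GG(1,2)[OF that] entails_carrier(2) by (auto simp: Fpow_def)
  obtain \<J> where J: "\<J> \<in> Fpow (Fpow S)"
     "\<forall>J\<in>\<J>. \<forall>B\<in>?I. \<exists>K\<in>\<G> B. K \<subseteq> J"
     "\<forall>C\<in>transversals S \<J>. \<exists>B\<in>?I. C \<in> transversals S (\<G> B)"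
    using disjunction_of_families[of ?I \<G> S, OF finI fam] by blast
  have "J \<in> adjoin \<R> A" if J': "J \<in> \<J>" for J
  proof (rule adjoinI[OF _ F(1)])
    show JS: "J \<in> Fpow S" using J(1) that by (auto simp: Fpow_def)
    fix B assume B: "B \<in> transversals S \<F>"
    have BI: "B \<inter> \<Union>\<F> \<in> ?I" using transversal_Int_Union[OF B] .
    obtain K where K: "K \<in> \<G> (B \<inter> \<Union>\<F>)" "K \<subseteq> J" using J(2) J' BI by blast
    show "A \<union> B \<turnstile> J"
      using GG(2)[OF BI K(1)] K(2) JS B A
      by (rule_tac entails_mono[of "A \<union> (B \<inter> \<Union>\<F>)" K]) (auto simp: transversals_def Fpow_def)
  qed
  then have "\<J> \<in> Fpow (adjoin \<R> A)" using J(1) by (auto simp: Fpow_def)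
  moreover have "\<forall>C\<in>transversals S \<J>. \<exists>g\<in>G. C \<turnstile> {g}" using J(3) GG(3) by blast
  ultimately show "\<exists>\<F>\<in>Fpow (adjoin \<R> A). \<forall>C\<in>transversals S \<F>. \<exists>g\<in>G. C \<turnstile> {g}" by blast
qed

text \<open>
  The syntactic form of the assertion that every model of \<open>\<R>\<close> includes a member of \<open>\<A>\<close>.
  Finiteness of \<open>\<F>\<close> makes its negation inductive, as Zorn's lemma requires.
\<close>
definition covered_by :: "'a set set \<Rightarrow> 'a set set \<Rightarrow> bool" where
  "covered_by \<R> \<A> \<longleftrightarrow> (\<exists>\<F>\<in>Fpow \<R>. bowtie S \<F> \<A>)"

text \<open>
  Case distinction over the transversals of \<open>\<F>\<^sub>0\<close>: the families that witness the covering in the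
  finitely many cases are combined into their disjunction, whose clauses hold in all cases and
  therefore already belong to \<open>\<R>\<close>.
\<close>
lemma covered_by_cases:
  assumes R: "round_theory \<R>" and F0: "\<F>\<^sub>0 \<in> Fpow \<R>"
    and cov: "\<And>A. A \<in> transversals S \<F>\<^sub>0 \<Longrightarrow> covered_by (adjoin \<R> A) \<A>"
  shows "covered_by \<R> \<A>"
proof -
  let ?I = "core_transversals S \<F>\<^sub>0"
  have finI: "finite ?I"
    by (rule finite_core_transversals[OF round_theory_finite_family[OF R F0]])
  obtain \<G> where GG: "\<And>A. A \<in> ?I \<Longrightarrow> \<G> A \<in> Fpow (adjoin \<R> A)"
      "\<And>A. A \<in> ?I \<Longrightarrow> bowtie S (\<G> A) \<A>"
    using cov[OF core_transversalD] unfolding covered_by_def by metis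
  have fam: "\<G> A \<in> Fpow (Fpow S)" if "A \<in> ?I" for A
    using GG(1)[OF that] by (auto simp: Fpow_def adjoin_def)
  obtain \<J> where J: "\<J> \<in> Fpow (Fpow S)"
     "\<forall>J\<in>\<J>. \<forall>A\<in>?I. \<exists>K\<in>\<G> A. K \<subseteq> J"
     "\<forall>C\<in>transversals S \<J>. \<exists>A\<in>?I. C \<in> transversals S (\<G> A)"
    using disjunction_of_families[of ?I \<G> S, OF finI fam] by blast
  have "J \<in> \<R>" if J': "J \<in> \<J>" for J
  proof -
    have JS: "J \<in> Fpow S" using J(1) that by (auto simp: Fpow_def)
    have "\<forall>A\<in>?I. \<exists>\<H>\<in>Fpow \<R>. \<exists>K. K \<subseteq> J \<and> (\<forall>B\<in>transversals S \<H>. A \<union> B \<turnstile> K)"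
    proof
      fix A assume A: "A \<in> ?I"
      obtain K where K: "K \<in> \<G> A" "K \<subseteq> J" using J(2) J' A by blast
      have "K \<in> adjoin \<R> A" using GG(1)[OF A] K(1) by (auto simp: Fpow_def)
      then show "\<exists>\<H>\<in>Fpow \<R>. \<exists>K. K \<subseteq> J \<and> (\<forall>B\<in>transversals S \<H>. A \<union> B \<turnstile> K)"
        using K(2) unfolding adjoin_def by blast
    qed
    then obtain \<H> k where H: "\<And>A. A \<in> ?I \<Longrightarrow> \<H> A \<in> Fpow \<R>"
      "\<And>A. A \<in> ?I \<Longrightarrow> k A \<subseteq> J"
      "\<And>A B. A \<in> ?I \<Longrightarrow> B \<in> transversals S (\<H> A) \<Longrightarrow> A \<union> B \<turnstile> k A"
      by metis
    let ?F = "\<F>\<^sub>0 \<union> (\<Union>A\<in>?I. \<H> A)"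
    have "?F \<in> Fpow \<R>" using F0 finite_UN_Fpow[OF finI H(1)] by (auto simp: Fpow_def)
    then show "J \<in> \<R>"
    proof (rule round_theory_cut[OF R JS])
      fix B assume B: "B \<in> transversals S ?F"
      let ?A = "B \<inter> \<Union>\<F>\<^sub>0"
      have "B \<in> transversals S \<F>\<^sub>0" using B by (auto simp: transversals_def)
      from transversal_Int_Union[OF this] have A: "?A \<in> ?I" .
      have "B \<in> transversals S (\<H> ?A)"
        using B transversals_antimono[of "\<H> ?A" ?F S] A by blast
      from H(3)[OF A this] have "B \<turnstile> k ?A" by (simp add: Un_absorb1)
      then show "B \<turnstile> J"
        using entails_mono[of B "k ?A" B J] H(2)[OF A] JS entails_carrier(1) by auto
    qed
  qed
  then have "\<J> \<in> Fpow \<R>" using J(1) by (auto simp: Fpow_def)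
  moreover have "bowtie S \<J> \<A>"
    using J(3) GG(2) unfolding bowtie_def by blast
  ultimately show ?thesis unfolding covered_by_def by blast
qed

lemma round_theory_Union_chain:
  assumes chain: "subset.chain {\<M>. round_theory \<M>} \<C>" and ne: "\<C> \<noteq> {}"
  shows "round_theory (\<Union>\<C>)"
  unfolding round_theory_def
proof (intro conjI ballI impI)
  have C: "round_theory \<M>" if "\<M> \<in> \<C>" for \<M>
    using chain that by (auto simp: subset.chain_def)
  show "\<Union>\<C> \<subseteq> Fpow S" using C round_theory_Fpow by blast
  fix G
  { fix \<F>
    assume G: "G \<in> Fpow S" and F: "\<F> \<in> Fpow (\<Union>\<C>)" and B: "\<forall>B\<in>transversals S \<F>. B \<turnstile> G"
    obtain \<M> where "\<M> \<in> \<C>" "\<F> \<subseteq> \<M>"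
      using finite_subset_Union_chain[of \<F> \<C>] F ne chain by (auto simp: Fpow_def)
    then show "G \<in> \<Union>\<C>"
      using round_theory_cut[OF C G, of \<M> \<F>] F B by (auto simp: Fpow_def) }
  assume "G \<in> \<Union>\<C>"
  then obtain \<M> where M: "\<M> \<in> \<C>" "G \<in> \<M>" by blast
  have "Fpow \<M> \<subseteq> Fpow (\<Union>\<C>)" using M(1) by (auto simp: Fpow_def)
  then show "\<exists>\<F>\<in>Fpow (\<Union>\<C>). \<forall>B\<in>transversals S \<F>. \<exists>g\<in>G. B \<turnstile> {g}"
    using round_theory_interpolate[OF C[OF M(1)] M(2)] by blast
qed

text \<open>
  Closure under cut makes the set of unit clauses meet everything it entails. For the converse,
  a unit clause follows from every transversal of some \<open>\<F> \<subseteq> \<M>\<close>, and primality provides a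
  transversal consisting of unit clauses.
\<close>
lemma tight_of_prime_round_theory:
  assumes M: "round_theory \<M>" and prime: "\<And>K. K \<in> \<M> \<Longrightarrow> \<exists>k\<in>K. {k} \<in> \<M>"
  shows "tight S E {k. {k} \<in> \<M>}" (is "tight S E ?T")
  unfolding tight_def
proof (intro conjI ballI iffI)
  show TS: "?T \<subseteq> S" using round_theory_Fpow[OF M] by (auto simp: Fpow_def)
  fix G assume G: "G \<in> Fpow S"
  { assume "\<exists>F. finite F \<and> F \<subseteq> ?T \<and> F \<turnstile> G"
    then obtain F where F: "finite F" "F \<subseteq> ?T" "F \<turnstile> G" by blast
    have "(\<lambda>f. {f}) ` F \<in> Fpow \<M>" using F by (auto simp: Fpow_def)
    then have "G \<in> \<M>"
    proof (rule round_theory_cut[OF M G])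
      fix B assume B: "B \<in> transversals S ((\<lambda>f. {f}) ` F)"
      then have "F \<subseteq> B" "B \<in> Fpow S" by (auto simp: transversals_def)
      then show "B \<turnstile> G" using entails_mono[OF F(3)] G by auto
    qed
    then show "?T \<inter> G \<noteq> {}" using prime by auto }
  assume "?T \<inter> G \<noteq> {}"
  then obtain t where t: "t \<in> G" "{t} \<in> \<M>" by auto
  obtain \<F> where F: "\<F> \<in> Fpow \<M>" "\<And>B. B \<in> transversals S \<F> \<Longrightarrow> B \<turnstile> {t}"
    using round_theory_cut_witness[OF M t(2)] by blast
  \<comment> \<open>The unit clauses occurring in \<open>\<F>\<close> form a transversal of \<open>\<F>\<close> by primality.\<close>
  let ?B = "?T \<inter> \<Union>\<F>"
  have "finite (\<Union>\<F>)" using F(1) round_theory_Fpow[OF M] by (auto simp: Fpow_def)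
  then have "?B \<in> transversals S \<F>"
    using F(1) prime TS unfolding transversals_def Fpow_def by blast
  from F(2)[OF this] have "?B \<turnstile> G" using entails_mono[of ?B "{t}" ?B G] t(1) G entails_carrier by auto
  then show "\<exists>F. finite F \<and> F \<subseteq> ?T \<and> F \<turnstile> G"
    using \<open>finite (\<Union>\<F>)\<close> by (intro exI[of _ ?B]) auto
qed

text \<open>
  The prime ideal theorem for round theories. The set \<open>T\<close> may be empty when \<open>\<R>\<close> is; a nonempty \<open>\<R>\<close>
  forces \<open>T\<close> to be nonempty, since \<open>T\<close> has to meet its clauses.
\<close>
lemma tight_model_avoiding:
  assumes R: "round_theory \<R>" and notcov: "\<not> covered_by \<R> \<A>"
  obtains T where "tight S E T" "\<And>K. K \<in> \<R> \<Longrightarrow> T \<inter> K \<noteq> {}"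
    "\<And>A. A \<in> \<A> \<Longrightarrow> finite A \<Longrightarrow> \<not> A \<subseteq> T"
proof -
  let ?Z = "{\<M>. round_theory \<M> \<and> \<R> \<subseteq> \<M> \<and> \<not> covered_by \<M> \<A>}"
  have "\<exists>\<M>\<in>?Z. \<forall>X\<in>?Z. \<M> \<subseteq> X \<longrightarrow> X = \<M>"
  proof (rule subset_Zorn_nonempty)
    show "?Z \<noteq> {}" using R notcov by auto
    fix \<C> assume ne: "\<C> \<noteq> {}" and chain: "subset.chain ?Z \<C>"
    have "subset.chain {\<M>. round_theory \<M>} \<C>" using chain by (auto simp: subset.chain_def)
    then have "round_theory (\<Union>\<C>)" using round_theory_Union_chain ne by blast
    moreover have "\<R> \<subseteq> \<Union>\<C>" using ne chain unfolding subset.chain_def by blast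
    moreover have "\<not> covered_by (\<Union>\<C>) \<A>"
    proof
      assume "covered_by (\<Union>\<C>) \<A>"
      then obtain \<F> where F: "\<F> \<in> Fpow (\<Union>\<C>)" "bowtie S \<F> \<A>" by (auto simp: covered_by_def)
      obtain \<M> where "\<M> \<in> \<C>" "\<F> \<subseteq> \<M>"
        using finite_subset_Union_chain[of \<F> \<C>] F ne chain by (auto simp: Fpow_def)
      then show False
        using F chain by (auto simp: subset.chain_def covered_by_def Fpow_def)
    qed
    ultimately show "\<Union>\<C> \<in> ?Z" by blast
  qed
  then obtain \<M> where M: "round_theory \<M>" "\<R> \<subseteq> \<M>" "\<not> covered_by \<M> \<A>"
    and max: "\<And>X. round_theory X \<Longrightarrow> \<M> \<subseteq> X \<Longrightarrow> \<not> covered_by X \<A> \<Longrightarrow> X = \<M>"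
    by (smt (verit) mem_Collect_eq subset_trans)
  have prime: "\<exists>k\<in>K. {k} \<in> \<M>" if K: "K \<in> \<M>" for K
  proof -
    obtain \<F> where F: "\<F> \<in> Fpow \<M>" "\<And>B. B \<in> transversals S \<F> \<Longrightarrow> \<exists>k\<in>K. B \<turnstile> {k}"
      using round_theory_interpolate[OF M(1) K] by blast
    obtain A where A: "A \<in> transversals S \<F>" "\<not> covered_by (adjoin \<M> A) \<A>"
      using covered_by_cases[OF M(1) F(1)] M(3) by blast
    have AS: "A \<in> Fpow S" using A(1) by (auto simp: transversals_def)
    have "adjoin \<M> A = \<M>"
      using max[OF round_theory_adjoin subset_adjoin] M(1) AS A(2) by blast
    moreover obtain k where "k \<in> K" "A \<turnstile> {k}" using F(2)[OF A(1)] by blast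
    ultimately show ?thesis using singleton_in_adjoin[of A k \<M>] by auto
  qed
  show thesis
  proof
    show "tight S E {k. {k} \<in> \<M>}" by (rule tight_of_prime_round_theory[OF M(1) prime])
    show "{k. {k} \<in> \<M>} \<inter> K \<noteq> {}" if "K \<in> \<R>" for K using prime[of K] M(2) that by auto
    show "\<not> A \<subseteq> {k. {k} \<in> \<M>}" if "A \<in> \<A>" "finite A" for A
    proof
      assume A: "A \<subseteq> {k. {k} \<in> \<M>}"
      have "(\<lambda>a. {a}) ` A \<in> Fpow \<M>" using A that by (auto simp: Fpow_def)
      moreover have "bowtie S ((\<lambda>a. {a}) ` A) \<A>"
        using \<open>A \<in> \<A>\<close> by (auto simp: bowtie_def transversals_def)
      ultimately show False using M(3) by (auto simp: covered_by_def)
    qed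
  qed
qed

section \<open>Models of round theories\<close>

definition models :: "'a set set \<Rightarrow> 'a set set" where
  "models \<R> = {T. tight S E T \<and> T \<noteq> {} \<and> (\<forall>K\<in>\<R>. T \<inter> K \<noteq> {})}"

text \<open>
  Completeness: a clause that holds in all models is in the theory. A model avoiding the singletons
  of \<open>G\<close> exists as soon as \<open>G \<notin> \<R>\<close>, because otherwise the elements outside \<open>G\<close> would form a transversal
  of a finite part of \<open>\<R>\<close>.
\<close>
lemma models_subset_tight_sup_imp_mem:
  assumes R: "round_theory \<R>" "\<R> \<noteq> {}" and G: "G \<in> Fpow S"
    and sub: "models \<R> \<subseteq> tight_sup S E G"
  shows "G \<in> \<R>"
proof (rule ccontr)
  assume "G \<notin> \<R>"
  let ?A = "(\<lambda>g. {g}) ` G"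
  have "\<not> covered_by \<R> ?A"
  proof
    assume "covered_by \<R> ?A"
    then obtain \<F> where F: "\<F> \<in> Fpow \<R>" "bowtie S \<F> ?A" by (auto simp: covered_by_def)
    have "finite (\<Union>\<F>)" "\<Union>\<F> \<subseteq> S" using F(1) round_theory_Fpow[OF R(1)] by (auto simp: Fpow_def)
    then have 1: "\<Union>\<F> - G \<in> Fpow S" by (auto simp: Fpow_def)
    moreover have "\<not> F \<subseteq> G" if "F \<in> \<F>" for F
      using round_theory_upward[OF R(1) _ _ G] \<open>G \<notin> \<R>\<close> F(1) that by (auto simp: Fpow_def)
    ultimately have "\<Union>\<F> - G \<in> transversals S \<F>" by (fastforce simp: transversals_def)
    then show False using F(2) by (auto simp: bowtie_def)
  qed
  then obtain T where T: "tight S E T" "\<And>K. K \<in> \<R> \<Longrightarrow> T \<inter> K \<noteq> {}"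
    "\<And>A. A \<in> ?A \<Longrightarrow> finite A \<Longrightarrow> \<not> A \<subseteq> T"
    using tight_model_avoiding[OF R(1)] by blast
  then have "T \<in> models \<R>" using R(2) by (auto simp: models_def)
  moreover have "T \<notin> tight_sup S E G" using T(3) by (auto simp: tight_sup_def)
  ultimately show False using sub by blast
qed

lemma tight_supported:
  assumes T: "tight S E T" and A: "finite A" "A \<subseteq> T"
  obtains F where "finite F" "F \<subseteq> T" "F \<in> Fpow S" "\<And>a. a \<in> A \<Longrightarrow> F \<turnstile> {a}"
proof -
  have TS: "T \<subseteq> S" using T by (auto simp: tight_def)
  have "\<exists>F. finite F \<and> F \<subseteq> T \<and> F \<turnstile> {a}" if "a \<in> A" for a
  proof -
    have "{a} \<in> Fpow S" "T \<inter> {a} \<noteq> {}" using that A TS by (auto simp: Fpow_def)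
    then show ?thesis using T unfolding tight_def by blast
  qed
  then obtain f where f: "\<And>a. a \<in> A \<Longrightarrow> finite (f a) \<and> f a \<subseteq> T \<and> f a \<turnstile> {a}" by metis
  let ?F = "\<Union>a\<in>A. f a"
  have FS: "?F \<in> Fpow S" using f A TS by (fastforce simp: Fpow_def)
  have "?F \<turnstile> {a}" if "a \<in> A" for a
    using f[OF that] FS that entails_carrier(2)
    by (rule_tac entails_mono[of "f a" "{a}"]) auto
  then show thesis using that[of ?F] f A FS by auto
qed

text \<open>
  From left to right, the roundness of \<open>T\<close> supplies a finite \<open>H \<subseteq> T\<close> entailing every \<open>f \<in> F\<close>;
  conversely, the models of \<open>{K. H \<turnstile> K}\<close> all include \<open>F\<close>, so completeness applies.
\<close>
lemma Vdash_iff_tight: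
  assumes F: "F \<in> Fpow S" and G: "G \<in> Fpow S"
  shows "Vdash S E F G \<longleftrightarrow> tight_sub S E F \<subseteq> tight_sup S E G"
proof
  assume V: "Vdash S E F G"
  show "tight_sub S E F \<subseteq> tight_sup S E G"
  proof
    fix T assume "T \<in> tight_sub S E F"
    then have T: "tight S E T" "T \<noteq> {}" "F \<subseteq> T" by (auto simp: tight_sub_def)
    obtain t where t: "t \<in> T" using T by auto
    \<comment> \<open>The extra element \<open>t\<close> makes \<open>H\<close> bounded even when \<open>F\<close> is empty.\<close>
    obtain H where H: "finite H" "H \<subseteq> T" "H \<in> Fpow S" "\<And>a. a \<in> insert t F \<Longrightarrow> H \<turnstile> {a}"
      using tight_supported[OF T(1), of "insert t F"] T(3) t F by (auto simp: Fpow_def)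
    have "H \<in> bounded_sets S E"
      using H(3) H(4)[of t] entails_carrier(2) by (auto simp: bounded_sets_def)
    then have "H \<turnstile> G" using V H(4) by (auto simp: Vdash_def)
    then show "T \<in> tight_sup S E G"
      using T H G unfolding tight_sup_def tight_def by blast
  qed
next
  assume sub: "tight_sub S E F \<subseteq> tight_sup S E G"
  have "H \<turnstile> G" if H: "H \<in> bounded_sets S E" "\<forall>f\<in>F. H \<turnstile> {f}" for H
  proof -
    have "models {K. H \<turnstile> K} \<subseteq> tight_sub S E F"
      using H(2) by (fastforce simp: models_def tight_sub_def)
    then have "G \<in> {K. H \<turnstile> K}"
      using H(1) sub round_theory_consequences[of H]
      by (intro models_subset_tight_sup_imp_mem[OF _ _ G]) (auto simp: bounded_sets_def)
    then show ?thesis by simp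
  qed
  then show "Vdash S E F G" using F G by (auto simp: Vdash_def)
qed

section \<open>The topology of the tight spectrum\<close>

abbreviation X :: "'a set topology" where "X \<equiv> tight_spectrum S E"

lemma tight_sub_Un: "tight_sub S E (A \<union> B) = tight_sub S E A \<inter> tight_sub S E B"
  by (auto simp: tight_sub_def)

lemma openin_tight_sub:
  assumes "finite A" "A \<subseteq> S"
  shows "openin X (tight_sub S E A)"
  using assms
proof (induction A)
  case empty
  have "tight_sub S E {} = topspace X"
    by (auto simp: topspace_tight_spectrum tight_sup_whole tight_sub_def)
  then show ?case by (simp only: openin_topspace)
next
  case (insert a A)
  have "openin X (tight_sub S E {a})"
    unfolding tight_spectrum_def using insert.prems by (intro topology_generated_by_Basis) auto
  then show ?case using insert tight_sub_Un[of "{a}" A] by (auto intro: openin_Int)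
qed

lemma openin_tight_spectrum_iff:
  "openin X U \<longleftrightarrow> U \<subseteq> topspace X \<and> (\<forall>T\<in>U. \<exists>A. finite A \<and> A \<subseteq> T \<and> tight_sub S E A \<subseteq> U)"
proof
  assume U: "openin X U"
  have "generate_topology_on ((\<lambda>p. tight_sub S E {p}) ` S) U"
    using U by (simp add: tight_spectrum_def openin_topology_generated_by_iff)
  then have "\<forall>T\<in>U. \<exists>A. finite A \<and> A \<subseteq> T \<and> tight_sub S E A \<subseteq> U"
  proof induction
    case (Int V W)
    show ?case
    proof
      fix T assume "T \<in> V \<inter> W"
      then have "T \<in> V" "T \<in> W" by auto
      then obtain A B where "finite A \<and> A \<subseteq> T \<and> tight_sub S E A \<subseteq> V"
        "finite B \<and> B \<subseteq> T \<and> tight_sub S E B \<subseteq> W"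
        using Int.IH by metis
      then show "\<exists>A. finite A \<and> A \<subseteq> T \<and> tight_sub S E A \<subseteq> V \<inter> W"
        by (intro exI[of _ "A \<union> B"]) (auto simp: tight_sub_Un)
    qed
  next
    case (UN K)
    then show ?case by (meson Union_iff Union_upper subset_trans)
  next
    case (Basis V)
    then obtain p where "V = tight_sub S E {p}" by blast
    then show ?case by (intro ballI exI[of _ "{p}"]) (auto simp: tight_sub_def)
  qed auto
  then show "U \<subseteq> topspace X \<and> (\<forall>T\<in>U. \<exists>A. finite A \<and> A \<subseteq> T \<and> tight_sub S E A \<subseteq> U)"
    using openin_subset[OF U] by blast
next
  assume U: "U \<subseteq> topspace X \<and> (\<forall>T\<in>U. \<exists>A. finite A \<and> A \<subseteq> T \<and> tight_sub S E A \<subseteq> U)"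
  show "openin X U"
  proof (subst openin_subopen, intro ballI)
    fix T assume T: "T \<in> U"
    have T': "tight S E T" "T \<noteq> {}"
      using T U by (auto simp: topspace_tight_spectrum tight_sup_whole)
    obtain A where A: "finite A" "A \<subseteq> T" "tight_sub S E A \<subseteq> U" using T U by blast
    have "A \<subseteq> S" using T' A(2) by (auto simp: tight_def)
    then have "openin X (tight_sub S E A)" using A(1) by (rule_tac openin_tight_sub)
    moreover have "T \<in> tight_sub S E A" using T' A(2) by (simp add: tight_sub_def)
    ultimately show "\<exists>V. openin X V \<and> T \<in> V \<and> V \<subseteq> U" using A(3) by blast
  qed
qed

lemma openin_tight_sup:
  assumes "G \<subseteq> S"
  shows "openin X (tight_sup S E G)"
proof -
  have "tight_sup S E G = (\<Union>g\<in>G. tight_sub S E {g})"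
    by (auto simp: tight_sup_def tight_sub_def)
  then show ?thesis using assms by (auto intro!: openin_tight_sub)
qed

text \<open>
  If no finite part of an open cover sufficed, a model could be found that includes no finite set
  \<open>A\<close> whose basic open set lies below a member of the cover. Such a model would be uncovered.
\<close>
lemma compactin_models:
  assumes R: "round_theory \<R>" "\<R> \<noteq> {}"
  shows "compactin X (models \<R>)"
  unfolding compactin_def
proof (intro conjI allI impI)
  show "models \<R> \<subseteq> topspace X"
    by (auto simp: topspace_tight_spectrum tight_sup_whole models_def)
  fix \<U> assume U: "(\<forall>U\<in>\<U>. openin X U) \<and> models \<R> \<subseteq> \<Union>\<U>"
  let ?A = "{A. finite A \<and> (\<exists>U\<in>\<U>. tight_sub S E A \<subseteq> U)}"
  have "covered_by \<R> ?A"
  proof (rule ccontr)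
    assume "\<not> covered_by \<R> ?A"
    then obtain T where T: "tight S E T" "\<And>K. K \<in> \<R> \<Longrightarrow> T \<inter> K \<noteq> {}"
      "\<And>A. A \<in> ?A \<Longrightarrow> finite A \<Longrightarrow> \<not> A \<subseteq> T"
      using tight_model_avoiding[OF R(1)] by blast
    have "T \<in> models \<R>" using T R(2) by (auto simp: models_def)
    then obtain W where "W \<in> \<U>" "T \<in> W" using U by blast
    then obtain A where "finite A" "A \<subseteq> T" "tight_sub S E A \<subseteq> W"
      using U openin_tight_spectrum_iff[of W] by blast
    then show False using T(3)[of A] \<open>W \<in> \<U>\<close> by blast
  qed
  then obtain \<F> where F: "\<F> \<in> Fpow \<R>" "bowtie S \<F> ?A" by (auto simp: covered_by_def)
  let ?I = "core_transversals S \<F>"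
  have finI: "finite ?I"
    by (rule finite_core_transversals[OF round_theory_finite_family[OF R(1) F(1)]])
  have "\<exists>U\<in>\<U>. \<exists>A. A \<subseteq> B \<and> tight_sub S E A \<subseteq> U" if B: "B \<in> ?I" for B
  proof -
    obtain A where "A \<in> ?A" "A \<subseteq> B"
      using bspec[OF F(2)[unfolded bowtie_def] core_transversalD[OF B]] by (rule bexE)
    then show ?thesis by blast
  qed
  then obtain u where u: "\<And>B. B \<in> ?I \<Longrightarrow> u B \<in> \<U> \<and> (\<exists>A. A \<subseteq> B \<and> tight_sub S E A \<subseteq> u B)"
    by metis
  have "models \<R> \<subseteq> \<Union>(u ` ?I)"
  proof
    fix T assume T: "T \<in> models \<R>"
    have "finite (\<Union>\<F>)" "\<Union>\<F> \<subseteq> S"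
      using round_theory_finite_family[OF R(1) F(1)] by (auto simp: Fpow_def)
    then have "T \<inter> \<Union>\<F> \<in> ?I"
      using T F(1) unfolding core_transversals_def transversals_def models_def Fpow_def by blast
    with u[OF this] T show "T \<in> \<Union>(u ` ?I)"
      by (auto simp: tight_sub_def models_def)
  qed
  then show "\<exists>\<V>. finite \<V> \<and> \<V> \<subseteq> \<U> \<and> models \<R> \<subseteq> \<Union>\<V>"
    using finI u by (intro exI[of _ "u ` ?I"]) auto
qed

lemma compactly_inside_via_compactin:
  assumes "compactin Y C" "p \<subseteq> C" "C \<subseteq> q" "q \<subseteq> topspace Y"
  shows "compactly_inside Y p q"
  using assms unfolding compactly_inside_def compactin_def by (meson subset_trans)

lemma tight_sub_subset_models:
  "tight_sub S E H \<subseteq> models {K. H \<turnstile> K}"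
proof
  fix T assume "T \<in> tight_sub S E H"
  then have T: "tight S E T" "T \<noteq> {}" "H \<subseteq> T" by (auto simp: tight_sub_def)
  have "T \<inter> K \<noteq> {}" if "H \<turnstile> K" for K
  proof -
    have "finite H" "K \<in> Fpow S" using entails_carrier[OF that] by (auto simp: Fpow_def)
    then show ?thesis using T that unfolding tight_def by blast
  qed
  then show "T \<in> models {K. H \<turnstile> K}" using T by (auto simp: models_def)
qed

lemma models_antimono: "\<R> \<subseteq> \<R>' \<Longrightarrow> models \<R>' \<subseteq> models \<R>"
  by (auto simp: models_def)

text \<open>
  For these \<open>H\<close> the basic open set of \<open>H\<close> is inside \<open>q\<close> with a compact set in between, the models
  of \<open>{K. H \<turnstile> K}\<close>. Boundedness of \<open>H\<close> guarantees that this theory is nonempty, hence its set of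
  models compact.
\<close>
definition inner_approx :: "'a set set \<Rightarrow> 'a set set" where
  "inner_approx q = {H \<in> bounded_sets S E. models {K. H \<turnstile> K} \<subseteq> q}"

lemma inner_approx_cover:
  assumes q: "openin X q" and T: "T \<in> q"
  obtains H where "H \<in> inner_approx q" "T \<in> tight_sub S E H"
proof -
  have T': "tight S E T" "T \<noteq> {}"
    using T openin_subset[OF q] by (auto simp: topspace_tight_spectrum tight_sup_whole)
  then obtain t where t: "t \<in> T" by blast
  obtain A where A: "finite A" "A \<subseteq> T" "tight_sub S E A \<subseteq> q"
    using q T openin_tight_spectrum_iff[of q] by blast
  \<comment> \<open>The extra element \<open>t\<close> makes \<open>H\<close> bounded even when \<open>A\<close> is empty.\<close>
  obtain H where H: "finite H" "H \<subseteq> T" "H \<in> Fpow S" "\<And>a. a \<in> insert t A \<Longrightarrow> H \<turnstile> {a}"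
    using tight_supported[OF T'(1), of "insert t A"] A t by auto
  have "H \<in> bounded_sets S E"
    using H(3) H(4)[of t] entails_carrier(2) by (auto simp: bounded_sets_def)
  moreover have "models {K. H \<turnstile> K} \<subseteq> tight_sub S E A"
    using H(4) by (fastforce simp: models_def tight_sub_def)
  ultimately show thesis
    using that[of H] A(3) T' H(2) by (auto simp: inner_approx_def tight_sub_def)
qed

text \<open>
  The sets \<open>tight_sub S E H\<close> with \<open>H \<in> inner_approx q\<close> form an open cover of \<open>q\<close>, and finite unions
  of the compact sets between them and \<open>q\<close> are compact.
\<close>
lemma compactly_inside_iff_inner_approx:
  assumes q: "openin X q"
  shows "compactly_inside X p q \<longleftrightarrow>
    (\<exists>\<H>. finite \<H> \<and> \<H> \<subseteq> inner_approx q \<and> p \<subseteq> (\<Union>H\<in>\<H>. tight_sub S E H))"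
proof
  assume p: "compactly_inside X p q"
  let ?U = "tight_sub S E ` inner_approx q"
  have "\<forall>U\<in>?U. openin X U"
    by (auto intro!: openin_tight_sub simp: inner_approx_def bounded_sets_def Fpow_def)
  moreover have "q \<subseteq> \<Union>?U" using inner_approx_cover[OF q] by blast
  ultimately have "\<exists>\<V>. finite \<V> \<and> \<V> \<subseteq> ?U \<and> p \<subseteq> \<Union>\<V>"
    using p[unfolded compactly_inside_def, THEN conjunct2, THEN conjunct2, THEN spec, of ?U]
    by (rule_tac mp) auto
  then obtain \<V> where "finite \<V>" "\<V> \<subseteq> ?U" "p \<subseteq> \<Union>\<V>" by blast
  then show "\<exists>\<H>. finite \<H> \<and> \<H> \<subseteq> inner_approx q \<and> p \<subseteq> (\<Union>H\<in>\<H>. tight_sub S E H)"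
    using finite_subset_image[of \<V> "tight_sub S E" "inner_approx q"] by blast
next
  assume "\<exists>\<H>. finite \<H> \<and> \<H> \<subseteq> inner_approx q \<and> p \<subseteq> (\<Union>H\<in>\<H>. tight_sub S E H)"
  then obtain \<H> where H: "finite \<H>" "\<H> \<subseteq> inner_approx q" "p \<subseteq> (\<Union>H\<in>\<H>. tight_sub S E H)"
    by blast
  have "compactin X (models {K. H \<turnstile> K})" if "H \<in> \<H>" for H
    using H(2) that round_theory_consequences[of H]
    by (intro compactin_models) (auto simp: inner_approx_def bounded_sets_def)
  then have "compactin X (\<Union>H\<in>\<H>. models {K. H \<turnstile> K})"
    using H(1) by (intro compactin_Union) auto
  then show "compactly_inside X p q"
  proof (rule compactly_inside_via_compactin)
    show "p \<subseteq> (\<Union>H\<in>\<H>. models {K. H \<turnstile> K})" using H(3) tight_sub_subset_models by blast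
    show "(\<Union>H\<in>\<H>. models {K. H \<turnstile> K}) \<subseteq> q" using H(2) by (auto simp: inner_approx_def)
  qed (rule openin_subset[OF q])
qed

lemma entails_imp_compactly_inside:
  assumes "F \<turnstile> G"
  shows "compactly_inside X (tight_sub S E F) (tight_sup S E G)"
proof -
  have S: "F \<in> Fpow S" "G \<in> Fpow S" using assms entails_carrier by auto
  have "F \<in> inner_approx (tight_sup S E G)"
    using S assms by (auto simp: inner_approx_def bounded_sets_def models_def tight_sup_def)
  then show ?thesis
    using S by (subst compactly_inside_iff_inner_approx)
      (auto intro!: openin_tight_sup exI[of _ "{F}"] simp: Fpow_def)
qed

lemma core_compact_tight_spectrum: "core_compact X"
  unfolding core_compact_def
proof (intro allI impI)
  fix p T assume pT: "openin X p \<and> T \<in> p"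
  then obtain H where H: "H \<in> inner_approx p" "T \<in> tight_sub S E H"
    using inner_approx_cover by blast
  have "openin X (tight_sub S E H)"
    using H(1) by (auto intro!: openin_tight_sub simp: inner_approx_def bounded_sets_def Fpow_def)
  moreover have "compactly_inside X (tight_sub S E H) p"
    using pT H(1) by (subst compactly_inside_iff_inner_approx) (auto intro!: exI[of _ "{H}"])
  ultimately show "\<exists>q. openin X q \<and> T \<in> q \<and> compactly_inside X q p" using H(2) by blast
qed

lemma inner_approx_Un:
  assumes H: "H \<in> inner_approx q" and H': "H' \<in> inner_approx r"
  shows "H \<union> H' \<in> inner_approx (q \<inter> r)"
proof -
  have S: "H \<in> Fpow S" "H' \<in> Fpow S"
    using assms by (auto simp: inner_approx_def bounded_sets_def)
  then have U: "H \<union> H' \<in> Fpow S" by (auto simp: Fpow_def)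
  have 1: "{K. H \<turnstile> K} \<subseteq> {K. H \<union> H' \<turnstile> K}" and 2: "{K. H' \<turnstile> K} \<subseteq> {K. H \<union> H' \<turnstile> K}"
    using entails_mono[OF _ _ order_refl U entails_carrier(2)] by auto
  show ?thesis
    using H H' U 1 models_antimono[OF 1] models_antimono[OF 2]
    unfolding inner_approx_def bounded_sets_def by blast
qed

lemma core_coherent_tight_spectrum: "core_coherent X"
  unfolding core_coherent_def
proof (intro allI impI)
  fix p q r
  assume *: "openin X p \<and> openin X q \<and> openin X r \<and>
     compactly_inside X p q \<and> compactly_inside X p r"
  obtain \<H> where H: "finite \<H>" "\<H> \<subseteq> inner_approx q" "p \<subseteq> (\<Union>H\<in>\<H>. tight_sub S E H)"
    using * compactly_inside_iff_inner_approx[of q p] by blast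
  obtain \<K> where K: "finite \<K>" "\<K> \<subseteq> inner_approx r" "p \<subseteq> (\<Union>H\<in>\<K>. tight_sub S E H)"
    using * compactly_inside_iff_inner_approx[of r p] by blast
  let ?H = "(\<lambda>(H, K). H \<union> K) ` (\<H> \<times> \<K>)"
  have "finite ?H" using H(1) K(1) by auto
  moreover have "?H \<subseteq> inner_approx (q \<inter> r)" using H(2) K(2) by (auto intro!: inner_approx_Un)
  moreover have "p \<subseteq> (\<Union>H\<in>?H. tight_sub S E H)" using H(3) K(3) by (fastforce simp: tight_sub_Un)
  ultimately show "compactly_inside X p (q \<inter> r)"
    using * compactly_inside_iff_inner_approx[of "q \<inter> r" p] openin_Int[of X q r] by blast
qed

text \<open>
  The specialisation order is inclusion, because the subbasic open sets are those of the form
  "contains \<open>p\<close>".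
\<close>
lemma closure_of_tight_point:
  assumes T: "T \<in> topspace X"
  shows "X closure_of {T} = {T' \<in> topspace X. T' \<subseteq> T}"
proof (intro set_eqI iffI)
  fix T' assume T': "T' \<in> X closure_of {T}"
  have "T' \<subseteq> S" using T' closure_of_subset_topspace[of X "{T}"]
    by (auto simp: topspace_tight_spectrum tight_sup_whole tight_def)
  have "T \<in> tight_sub S E {p}" if "p \<in> T'" for p
  proof -
    have "openin X (tight_sub S E {p})" using that \<open>T' \<subseteq> S\<close> by (auto intro: openin_tight_sub)
    moreover have "T' \<in> tight_sub S E {p}"
      using that T' closure_of_subset_topspace[of X "{T}"]
      by (auto simp: topspace_tight_spectrum tight_sup_whole tight_sub_def)
    ultimately show ?thesis using T' unfolding in_closure_of by blast
  qed
  then show "T' \<in> {T' \<in> topspace X. T' \<subseteq> T}"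
    using T' closure_of_subset_topspace[of X "{T}"] by (auto simp: tight_sub_def)
next
  fix T' assume T': "T' \<in> {T' \<in> topspace X. T' \<subseteq> T}"
  have "T \<in> U" if "openin X U" "T' \<in> U" for U
  proof -
    obtain A where "A \<subseteq> T'" "tight_sub S E A \<subseteq> U"
      using \<open>openin X U\<close> \<open>T' \<in> U\<close> unfolding openin_tight_spectrum_iff by blast
    then show ?thesis
      using T T' by (auto simp: topspace_tight_spectrum tight_sup_whole tight_sub_def)
  qed
  then show "T' \<in> X closure_of {T}" using T' by (auto simp: in_closure_of)
qed

lemma irreducible_closedin_Int:
  assumes C: "irreducible_closedin Y C" and U: "openin Y U" "U \<inter> C \<noteq> {}"
    and V: "openin Y V" "V \<inter> C \<noteq> {}"
  shows "U \<inter> V \<inter> C \<noteq> {}"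
proof
  assume "U \<inter> V \<inter> C = {}"
  then have "C = (C - U) \<union> (C - V)" by auto
  moreover have "closedin Y (C - U)" "closedin Y (C - V)"
    using C U V by (auto simp: irreducible_closedin_def closedin_diff)
  ultimately have "C = C - U \<or> C = C - V" using C unfolding irreducible_closedin_def by blast
  then show False using U V by auto
qed

text \<open>
  The generic point of \<open>C\<close> can only be \<open>\<Union>C\<close>. Irreducibility makes every finite subset of \<open>\<Union>C\<close> be
  included in a single member of \<open>C\<close>, so tightness passes from the members to the union.
\<close>
lemma sober_tight_spectrum: "sober_space X"
  unfolding sober_space_def
proof (intro allI impI)
  fix C assume C: "irreducible_closedin X C"
  then have closed: "closedin X C" and ne: "C \<noteq> {}" by (auto simp: irreducible_closedin_def)
  have CT: "tight S E T'" "T' \<noteq> {}" if "T' \<in> C" for T'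
    using closedin_subset[OF closed] that by (auto simp: topspace_tight_spectrum tight_sup_whole)
  define T where "T = \<Union>C"
  have TS: "T \<subseteq> S" using CT by (auto simp: T_def tight_def)
  have meet: "tight_sub S E A \<inter> C \<noteq> {}" if "finite A" "A \<subseteq> T" for A
    using that
  proof (induction A)
    case empty
    then show ?case using ne CT by (auto simp: tight_sub_def)
  next
    case (insert a A)
    have "tight_sub S E {a} \<inter> C \<noteq> {}" using insert.prems CT by (auto simp: T_def tight_sub_def)
    moreover have "openin X (tight_sub S E {a})" "openin X (tight_sub S E A)"
      using insert.hyps insert.prems TS by (auto intro!: openin_tight_sub)
    ultimately show ?case
      using irreducible_closedin_Int[OF C, of "tight_sub S E {a}" "tight_sub S E A"] insert
        tight_sub_Un[of "{a}" A] by auto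
  qed
  have "tight S E T"
    unfolding tight_def
  proof (intro conjI ballI iffI TS)
    fix G assume G: "G \<in> Fpow S"
    { assume "\<exists>F. finite F \<and> F \<subseteq> T \<and> F \<turnstile> G"
      then obtain F where F: "finite F" "F \<subseteq> T" "F \<turnstile> G" by blast
      obtain T' where T': "T' \<in> C" "F \<subseteq> T'" using meet[OF F(1,2)] by (auto simp: tight_sub_def)
      then have "T' \<inter> G \<noteq> {}" using CT(1)[OF T'(1)] F G unfolding tight_def by blast
      then show "T \<inter> G \<noteq> {}" using T'(1) by (auto simp: T_def) }
    assume "T \<inter> G \<noteq> {}"
    then obtain T' where T': "T' \<in> C" "T' \<inter> G \<noteq> {}" by (auto simp: T_def)
    then obtain F where "finite F" "F \<subseteq> T'" "F \<turnstile> G"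
      using CT(1)[OF T'(1)] G unfolding tight_def by blast
    then show "\<exists>F. finite F \<and> F \<subseteq> T \<and> F \<turnstile> G" using T'(1) by (auto simp: T_def)
  qed
  moreover have "T \<noteq> {}" using ne CT by (auto simp: T_def)
  ultimately have top: "T \<in> topspace X" by (auto simp: topspace_tight_spectrum tight_sup_whole)
  have "T \<in> C"
  proof (rule ccontr)
    assume "T \<notin> C"
    then have "T \<in> topspace X - C" "openin X (topspace X - C)" using top closed by auto
    then obtain A where "finite A" "A \<subseteq> T" "tight_sub S E A \<subseteq> topspace X - C"
      using openin_tight_spectrum_iff[of "topspace X - C"] by blast
    then show False using meet[of A] by auto
  qed
  have "C = X closure_of {T}"
  proof
    show "C \<subseteq> X closure_of {T}"
      unfolding closure_of_tight_point[OF top] using closedin_subset[OF closed] Union_upper[of _ C]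
      unfolding T_def[symmetric] by blast
    show "X closure_of {T} \<subseteq> C" using \<open>T \<in> C\<close> closed by (simp add: closure_of_minimal)
  qed
  then show "\<exists>!x. x \<in> topspace X \<and> C = X closure_of {x}"
    using top by (intro ex1I[of _ T]) (auto simp: closure_of_tight_point)
qed

lemma stably_locally_compact_tight_spectrum: "stably_locally_compact X"
  by (simp add: stably_locally_compact_def core_compact_tight_spectrum
    core_coherent_tight_spectrum sober_tight_spectrum)

section \<open>Cover relations\<close>

lemma Vdash_mono:
  assumes "Vdash S E F G" "F \<subseteq> F'" "F' \<in> Fpow S"
  shows "Vdash S E F' G"
  using assms by (auto simp: Vdash_def)

text \<open>
  Auxiliarity discharges one clause \<open>F \<Turnstile> K\<close>; repeating it, with the chosen elements
  accumulating on the left of \<open>\<turnstile>\<close>, discharges a finite conjunction of clauses.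
\<close>
lemma auxiliary_cut_transversals:
  assumes aux: "auxiliary_to S E (Vdash S E)" and "finite \<K>"
    and "F \<in> Fpow S" "G \<in> Fpow S"
    and "\<And>K. K \<in> \<K> \<Longrightarrow> Vdash S E F K"
    and "\<And>B. B \<in> transversals S \<K> \<Longrightarrow> F \<union> B \<turnstile> G"
  shows "F \<turnstile> G"
  using assms(2,3,5,6)
proof (induction \<K> arbitrary: F)
  case empty
  \<comment> \<open>The empty set is a transversal of the empty family.\<close>
  have "F \<union> {} \<turnstile> G" by (rule empty.prems(3)) (auto simp: transversals_def Fpow_def)
  then show ?case by simp
next
  case (insert K \<K>)
  have KS: "K \<in> Fpow S" using insert.prems(2)[of K] by (auto simp: Vdash_def)
  have "{k} \<union> F \<turnstile> G" if k: "k \<in> K" for k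
  proof (rule insert.IH)
    show kF: "{k} \<union> F \<in> Fpow S" using k KS insert.prems(1) by (auto simp: Fpow_def)
    show "Vdash S E ({k} \<union> F) L" if "L \<in> \<K>" for L
      using Vdash_mono[OF insert.prems(2) _ kF] that by auto
    show "({k} \<union> F) \<union> B \<turnstile> G" if B: "B \<in> transversals S \<K>" for B
    proof -
      have "{k} \<union> B \<in> transversals S (insert K \<K>)"
        using B k KS by (auto simp: transversals_def Fpow_def)
      from insert.prems(3)[OF this] show ?thesis by (simp add: Un_ac)
    qed
  qed
  then show ?case
    using aux insert.prems(1,2) KS \<open>G \<in> Fpow S\<close> unfolding auxiliary_to_def by blast
qed

text \<open>
  Semantically, \<open>F\<close> implies the disjunction of finitely many conjunctions \<open>H\<close> with \<open>H \<turnstile> G\<close>. As \<open>\<Turnstile>\<close> has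
  clauses on the right, this disjunction is first distributed: its clauses are the members of \<open>\<K>\<close>,
  and every transversal of \<open>\<K>\<close> includes one of the \<open>H\<close>.
\<close>
lemma compactly_inside_imp_entails:
  assumes cov: "cover_relation S E" and F: "F \<in> Fpow S" and G: "G \<in> Fpow S"
    and ci: "compactly_inside X (tight_sub S E F) (tight_sup S E G)"
  shows "F \<turnstile> G"
proof -
  have "openin X (tight_sup S E G)" using G by (auto intro: openin_tight_sup simp: Fpow_def)
  from ci[unfolded compactly_inside_iff_inner_approx[OF this]]
  obtain \<H> where H: "finite \<H>" "\<H> \<subseteq> inner_approx (tight_sup S E G)"
      "tight_sub S E F \<subseteq> (\<Union>H\<in>\<H>. tight_sub S E H)"
    by blast
  have HS: "H \<in> Fpow S" if "H \<in> \<H>" for H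
    using H(2) that by (auto simp: inner_approx_def bounded_sets_def)
  have HG: "H \<turnstile> G" if "H \<in> \<H>" for H
  proof -
    have "G \<in> {K. H \<turnstile> K}"
      using H(2) that round_theory_consequences[OF HS[OF that]]
      by (intro models_subset_tight_sup_imp_mem[OF _ _ G]) (auto simp: inner_approx_def bounded_sets_def)
    then show ?thesis by simp
  qed
  have fam: "(\<lambda>h. {h}) ` H \<in> Fpow (Fpow S)" if "H \<in> \<H>" for H
    using HS[OF that] by (auto simp: Fpow_def)
  obtain \<K> where K: "\<K> \<in> Fpow (Fpow S)"
     "\<forall>K\<in>\<K>. \<forall>H\<in>\<H>. \<exists>L\<in>(\<lambda>h. {h}) ` H. L \<subseteq> K"
     "\<forall>B\<in>transversals S \<K>. \<exists>H\<in>\<H>. B \<in> transversals S ((\<lambda>h. {h}) ` H)"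
    using disjunction_of_families[of \<H> "\<lambda>H. (\<lambda>h. {h}) ` H" S, OF H(1) fam] by blast
  have "auxiliary_to S E (Vdash S E)" using cov by (auto simp: cover_relation_def)
  moreover have "finite \<K>" using K(1) by (auto simp: Fpow_def)
  ultimately show ?thesis
  proof (rule auxiliary_cut_transversals[OF _ _ F G])
    fix K assume K': "K \<in> \<K>"
    then have KS: "K \<in> Fpow S" using K(1) by (auto simp: Fpow_def)
    have "H \<inter> K \<noteq> {}" if "H \<in> \<H>" for H using K(2) K' that by fastforce
    then have "tight_sub S E H \<subseteq> tight_sup S E K" if "H \<in> \<H>" for H
      using that by (fastforce simp: tight_sub_def tight_sup_def)
    then show "Vdash S E F K" unfolding Vdash_iff_tight[OF F KS] using H(3) by blast
  next
    fix B assume B: "B \<in> transversals S \<K>"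
    then obtain H where H: "H \<in> \<H>" "B \<in> transversals S ((\<lambda>h. {h}) ` H)" using K(3) by blast
    have "F \<union> B \<in> Fpow S" using F B by (auto simp: transversals_def Fpow_def)
    moreover have "H \<subseteq> F \<union> B" using H(2) by (auto simp: transversals_def)
    ultimately show "F \<union> B \<turnstile> G" using entails_mono[OF HG[OF H(1)]] G by auto
  qed
qed

end

section \<open>The representation theorem\<close>

theorem theorem3p7:
  fixes S :: "'a set" and E :: "'a set \<Rightarrow> 'a set \<Rightarrow> bool"
  assumes "strong_idempotent S E"
  shows "stably_locally_compact (tight_spectrum S E) \<and>
    (\<forall>F \<in> Fpow S. \<forall>G \<in> Fpow S. Vdash S E F G \<longleftrightarrow> tight_sub S E F \<subseteq> tight_sup S E G) \<and>
    (\<forall>F \<in> Fpow S. \<forall>G \<in> Fpow S. E F G \<longrightarrow>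
       compactly_inside (tight_spectrum S E) (tight_sub S E F) (tight_sup S E G)) \<and>
    (cover_relation S E \<longrightarrow>
       (\<forall>F \<in> Fpow S. \<forall>G \<in> Fpow S. E F G \<longleftrightarrow>
          compactly_inside (tight_spectrum S E) (tight_sub S E F) (tight_sup S E G)))"
proof -
  interpret strong_idempotent_rel S E by unfold_locales (rule assms)
  show ?thesis
    using stably_locally_compact_tight_spectrum Vdash_iff_tight entails_imp_compactly_inside
      compactly_inside_imp_entails by blast
qed

end
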